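(* Let $G$ be a cubic graph of order $n$ and let $\mathcal{C}$ be a $4$-total coloring of $G$ with color set $\{1,2,3,4\}$. For each $i \in \{1,2,3,4\}$, let $S_i$ be the set of vertices of color $i$, let $M_i$ be the set of edges of color $i$, and let $c_i = S_i \cup M_i$ be the color class of color $i$. Then: (i) $(S_1,S_2,S_3,S_4)$ is a partition of $V(G)$ into (possibly empty) independent sets; (ii) for each $i$, the set $M_i$ is a perfect matching of $G - S_i$; (iii) $(M_1,M_2,M_3,M_4)$ is a partition of $E(G)$; (iv) for each $i$, the cardinality $|S_i|$ is even and $|c_i| = (n + |S_i|)/2$. Conversely, if $G$ is a cubic graph, $(S_1,S_2,S_3,S_4)$ is a partition of $V(G)$ into (possibly empty) independent sets and $(M_1,M_2,M_3,M_4)$ is a partition of $E(G)$ such that each $M_i$ is a perfect matching of $G - S_i$, then assigning color $i$ to the vertices of $S_i$ and to the edges of $M_i$ yields a $4$-total coloring of $G$.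
   Context: All graphs are finite, simple and cubic ($3$-regular), not necessarily connected. The order of a graph is its number of vertices. A $4$-total coloring of $G$ assigns one of the four colors $1,2,3,4$ to each vertex and each edge of $G$ so that adjacent vertices receive distinct colors, adjacent edges (edges sharing an endpoint) receive distinct colors, and every vertex and edge that are incident receive distinct colors. For $S \subseteq V(G)$, $G - S$ denotes the subgraph induced by $V(G)\setminus S$. The color class $c_i$ is the set of all elements (vertices and edges) of color $i$. *)

theory Defs
  imports Complex_Main "HOL-Library.Disjoint_Sets"
begin

(* A graph is a pair of a vertex set and an edge set; an edge is the
   two-element set of its endpoints. *)
type_synonym 'a pregraph = "'a set \<times> 'a set set"

abbreviation verts :: "'a pregraph \<Rightarrow> 'a set" where
  "verts G \<equiv> fst G"

abbreviation edges :: "'a pregraph \<Rightarrow> 'a set set" where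
  "edges G \<equiv> snd G"

definition simple_graph :: "'a pregraph \<Rightarrow> bool" where
  "simple_graph G \<longleftrightarrow> finite (verts G) \<and> (\<forall>e\<in>edges G. e \<subseteq> verts G \<and> card e = 2)"

definition degree :: "'a pregraph \<Rightarrow> 'a \<Rightarrow> nat" where
  "degree G v = card {e \<in> edges G. v \<in> e}"

definition cubic_graph :: "'a pregraph \<Rightarrow> bool" where
  "cubic_graph G \<longleftrightarrow> simple_graph G \<and> (\<forall>v\<in>verts G. degree G v = 3)"

definition delete_verts :: "'a pregraph \<Rightarrow> 'a set \<Rightarrow> 'a pregraph" where
  "delete_verts G S = (verts G - S, {e \<in> edges G. e \<subseteq> verts G - S})"

definition independent_set :: "'a pregraph \<Rightarrow> 'a set \<Rightarrow> bool" where
  "independent_set G S \<longleftrightarrow> S \<subseteq> verts G \<and> (\<forall>u\<in>S. \<forall>v\<in>S. {u, v} \<notin> edges G)"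

definition perfect_matching :: "'a pregraph \<Rightarrow> 'a set set \<Rightarrow> bool" where
  "perfect_matching G M \<longleftrightarrow> M \<subseteq> edges G \<and> disjoint M \<and> \<Union>M = verts G"

(* Parts of an indexed partition may be empty, unlike the blocks of partition_on. *)
definition indexed_partition :: "'i set \<Rightarrow> ('i \<Rightarrow> 'b set) \<Rightarrow> 'b set \<Rightarrow> bool" where
  "indexed_partition I P A \<longleftrightarrow> disjoint_family_on P I \<and> (\<Union>i\<in>I. P i) = A"

(* The elements of G are verts G <+> edges G: Inl tags vertices and Inr tags edges.
   The values of f on other arguments are irrelevant. *)
definition total_coloring :: "nat \<Rightarrow> 'a pregraph \<Rightarrow> ('a + 'a set \<Rightarrow> nat) \<Rightarrow> bool" where
  "total_coloring k G f \<longleftrightarrow>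
     (\<forall>x \<in> verts G <+> edges G. f x \<in> {1..k}) \<and>
     (\<forall>u\<in>verts G. \<forall>v\<in>verts G. {u, v} \<in> edges G \<longrightarrow> f (Inl u) \<noteq> f (Inl v)) \<and>
     (\<forall>d\<in>edges G. \<forall>e\<in>edges G. d \<noteq> e \<and> d \<inter> e \<noteq> {} \<longrightarrow> f (Inr d) \<noteq> f (Inr e)) \<and>
     (\<forall>v\<in>verts G. \<forall>e\<in>edges G. v \<in> e \<longrightarrow> f (Inl v) \<noteq> f (Inr e))"

definition vertices_of_color :: "'a pregraph \<Rightarrow> ('a + 'a set \<Rightarrow> nat) \<Rightarrow> nat \<Rightarrow> 'a set" where
  "vertices_of_color G f i = {v \<in> verts G. f (Inl v) = i}"

definition edges_of_color :: "'a pregraph \<Rightarrow> ('a + 'a set \<Rightarrow> nat) \<Rightarrow> nat \<Rightarrow> 'a set set" where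
  "edges_of_color G f i = {e \<in> edges G. f (Inr e) = i}"

definition color_class :: "'a pregraph \<Rightarrow> ('a + 'a set \<Rightarrow> nat) \<Rightarrow> nat \<Rightarrow> ('a + 'a set) set" where
  "color_class G f i = vertices_of_color G f i <+> edges_of_color G f i"

definition assigns_colors ::
  "nat set \<Rightarrow> (nat \<Rightarrow> 'a set) \<Rightarrow> (nat \<Rightarrow> 'a set set) \<Rightarrow> ('a + 'a set \<Rightarrow> nat) \<Rightarrow> bool" where
  "assigns_colors I S M f \<longleftrightarrow>
     (\<forall>i\<in>I. (\<forall>v\<in>S i. f (Inl v) = i) \<and> (\<forall>e\<in>M i. f (Inr e) = i))"

end

theory Submission
  imports Defs
begin

text \<open>
  At a vertex \<open>v\<close> of degree 3 the four elements consisting of \<open>v\<close> and its three edges are pairwise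
  adjacent or incident, so a 4-total coloring uses each color exactly once on them. Hence the edges
  of color \<open>i\<close> cover exactly the vertices that do not have color \<open>i\<close>, which gives
  \<open>2 |M\<^sub>i| = n - |S\<^sub>i|\<close>. As \<open>n\<close> is even by the handshake lemma, so is \<open>|S\<^sub>i|\<close>. In the converse
  direction, each condition on a total coloring reads off from one of the partition, independence
  and matching hypotheses.
\<close>

section \<open>Edges, degrees and matchings in finite simple graphs\<close>

lemma simple_graph_finite_edges:
  assumes "simple_graph G"
  shows "finite (edges G)"
proof (rule finite_subset)
  show "edges G \<subseteq> Pow (verts G)"
    using assms by (auto simp: simple_graph_def)
  show "finite (Pow (verts G))"
    using assms by (simp add: simple_graph_def)
qed

lemma simple_graph_edgeE:
  assumes "simple_graph G" "e \<in> edges G"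
  obtains u v where "e = {u, v}" "u \<noteq> v" "u \<in> verts G" "v \<in> verts G"
proof -
  have "card e = 2" "e \<subseteq> verts G"
    using assms by (auto simp: simple_graph_def)
  moreover from this(1) obtain u v where "e = {u, v}" "u \<noteq> v"
    by (meson card_2_iff)
  ultimately show ?thesis
    using that by blast
qed

lemma simple_graph_delete_verts:
  "simple_graph G \<Longrightarrow> simple_graph (delete_verts G S)"
  by (auto simp: simple_graph_def delete_verts_def)

text \<open>Double counting of the pairs of a vertex and an edge containing it: every edge
  contributes two.\<close>

lemma handshake:
  assumes "simple_graph G"
  shows "(\<Sum>v\<in>verts G. degree G v) = 2 * card (edges G)"
proof -
  have "(\<Sum>v\<in>verts G. card {e \<in> edges G. v \<in> e}) = 2 * card (edges G)"
  proof (rule sum_multicount)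
    show "finite (verts G)" "finite (edges G)"
      using assms simple_graph_finite_edges[OF assms] by (simp_all add: simple_graph_def)
    show "\<forall>e\<in>edges G. card {v \<in> verts G. v \<in> e} = 2"
    proof
      fix e assume "e \<in> edges G"
      then have "{v \<in> verts G. v \<in> e} = e" "card e = 2"
        using assms by (auto simp: simple_graph_def)
      then show "card {v \<in> verts G. v \<in> e} = 2" by simp
    qed
  qed
  then show ?thesis by (simp add: degree_def)
qed

lemma cubic_graph_even_order:
  assumes "cubic_graph G"
  shows "even (card (verts G))"
proof -
  have "(\<Sum>v\<in>verts G. degree G v) = card (verts G) * 3"
    using assms by (simp add: cubic_graph_def)
  then have "card (verts G) * 3 = 2 * card (edges G)"
    using handshake[of G] assms by (simp add: cubic_graph_def)
  then have "even (card (verts G) * 3)" by simp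
  then show ?thesis by simp
qed

lemma card_perfect_matching:
  assumes "simple_graph G" "perfect_matching G M"
  shows "card (verts G) = 2 * card M"
proof -
  have M: "M \<subseteq> edges G" "disjoint M" "\<Union>M = verts G"
    using assms by (auto simp: perfect_matching_def)
  have card2: "card e = 2" if "e \<in> M" for e
    using that M(1) assms(1) by (auto simp: simple_graph_def)
  \<comment> \<open>An infinite set has \<open>card\<close> 0, so cardinality 2 forces
    finiteness.\<close>
  have fin: "finite e" if "e \<in> M" for e
    using card2[OF that] card.infinite by fastforce
  have "card (\<Union>M) = sum card M"
    using M(2) fin by (rule card_Union_disjoint)
  then show ?thesis
    using M(3) card2 by simp
qed

section \<open>From a total coloring to partitions and matchings\<close>

lemma total_coloring_colors_at:
  assumes G: "simple_graph G" and f: "total_coloring (Suc (degree G v)) G f" and v: "v \<in> verts G"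
  shows "insert (f (Inl v)) (f ` Inr ` {e \<in> edges G. v \<in> e}) = {1..Suc (degree G v)}"
    (is "insert _ (f ` Inr ` ?E) = _")
proof (rule card_subset_eq)
  have fin: "finite ?E"
    using simple_graph_finite_edges[OF G] by simp
  show "insert (f (Inl v)) (f ` Inr ` ?E) \<subseteq> {1..Suc (degree G v)}"
  proof -
    have "\<forall>x\<in>verts G <+> edges G. f x \<in> {1..Suc (degree G v)}"
      using f by (simp add: total_coloring_def)
    then show ?thesis using v by auto
  qed
  \<comment> \<open>Distinct edges of \<open>?E\<close> meet in \<open>v\<close>, so their colors
    differ. Together with the color of \<open>v\<close> this gives \<open>degree G v + 1\<close>
    distinct colors, as many as are available, so none is missing.\<close>
  have "inj_on (\<lambda>e. f (Inr e)) ?E"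
    using f unfolding inj_on_def total_coloring_def by blast
  then have "card (f ` Inr ` ?E) = degree G v"
    by (simp add: image_image card_image degree_def)
  moreover have "f (Inl v) \<notin> f ` Inr ` ?E"
    using f v unfolding total_coloring_def by blast
  ultimately show "card (insert (f (Inl v)) (f ` Inr ` ?E)) = card {1..Suc (degree G v)}"
    using fin by simp
qed simp

lemma total_coloring_indexed_partition_vertices:
  assumes "total_coloring k G f"
  shows "indexed_partition {1..k} (vertices_of_color G f) (verts G)"
  using assms
  by (auto simp: indexed_partition_def disjoint_family_on_def vertices_of_color_def
      total_coloring_def)

lemma total_coloring_indexed_partition_edges:
  assumes "total_coloring k G f"
  shows "indexed_partition {1..k} (edges_of_color G f) (edges G)"
  using assms
  by (auto simp: indexed_partition_def disjoint_family_on_def edges_of_color_def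
      total_coloring_def)

lemma total_coloring_independent_set:
  assumes "total_coloring k G f"
  shows "independent_set G (vertices_of_color G f i)"
proof -
  \<comment> \<open>The case \<open>u = v\<close> is included: the coloring condition then says that
    \<open>{u, u}\<close> is not an edge, as \<open>independent_set\<close> demands.\<close>
  have "f (Inl v) \<noteq> f (Inl u)" if "u \<in> verts G" "v \<in> verts G" "{u, v} \<in> edges G" for u v
    using assms that unfolding total_coloring_def by metis
  then show ?thesis
    by (auto simp: independent_set_def vertices_of_color_def)
qed

text \<open>With \<open>k + 1\<close> colors and all degrees equal to \<open>k\<close>, every color
  occurs at every vertex. A vertex not colored \<open>i\<close> thus has an edge of color
  \<open>i\<close>, and only one, since edges of equal color do not meet; a vertex colored
  \<open>i\<close> has none.\<close>

lemma total_coloring_perfect_matching: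
  assumes G: "simple_graph G" and regular: "\<forall>v\<in>verts G. degree G v = k"
    and f: "total_coloring (Suc k) G f" and i: "i \<in> {1..Suc k}"
  shows "perfect_matching (delete_verts G (vertices_of_color G f i)) (edges_of_color G f i)"
    (is "perfect_matching ?H ?M")
proof -
  have sub: "e \<subseteq> verts ?H" if "e \<in> ?M" for e
  proof
    fix v assume v: "v \<in> e"
    have e: "e \<in> edges G" "f (Inr e) = i"
      using that by (auto simp: edges_of_color_def)
    then have "v \<in> verts G"
      using G v by (auto simp: simple_graph_def)
    moreover from this have "f (Inl v) \<noteq> i"
      using f e v unfolding total_coloring_def by metis
    ultimately show "v \<in> verts ?H"
      by (simp add: delete_verts_def vertices_of_color_def)
  qed
  have "?M \<subseteq> edges ?H"
    using sub by (auto simp: delete_verts_def edges_of_color_def)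
  moreover have "disjoint ?M"
    using f unfolding disjoint_def edges_of_color_def total_coloring_def
    by (metis (mono_tags, lifting) mem_Collect_eq)
  moreover have "verts ?H \<subseteq> \<Union>?M"
  proof
    fix v assume "v \<in> verts ?H"
    then have v: "v \<in> verts G" "f (Inl v) \<noteq> i"
      by (auto simp: delete_verts_def vertices_of_color_def)
    \<comment> \<open>Color \<open>i\<close> is present at \<open>v\<close> but not on
      \<open>v\<close> itself, so some edge at \<open>v\<close> carries it.\<close>
    have "i \<in> insert (f (Inl v)) (f ` Inr ` {e \<in> edges G. v \<in> e})"
      using total_coloring_colors_at[OF G _ v(1), of f] f regular v(1) i by simp
    with v(2) show "v \<in> \<Union>?M"
      by (auto simp: edges_of_color_def)
  qed
  ultimately show ?thesis
    using sub by (auto simp: perfect_matching_def)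
qed

text \<open>If no edge had color \<open>i\<close>, all vertices would have it, so there would be no edges at all.\<close>
lemma perfect_matching_delete_independent_nonempty:
  assumes G: "simple_graph G" and e: "e \<in> edges G"
    and S: "independent_set G S" and M: "perfect_matching (delete_verts G S) M"
  shows "M \<noteq> {}"
proof
  assume "M = {}"
  then have "verts G \<subseteq> S"
    using M by (auto simp: perfect_matching_def delete_verts_def)
  moreover obtain u v where "e = {u, v}" "u \<in> verts G" "v \<in> verts G"
    using simple_graph_edgeE[OF G e] .
  ultimately show False
    using S e by (auto simp: independent_set_def)
qed

lemma card_color_class:
  assumes "simple_graph G"
  shows "card (color_class G f i) = card (vertices_of_color G f i) + card (edges_of_color G f i)"
proof -
  have "finite (vertices_of_color G f i)" "finite (edges_of_color G f i)"
    using assms simple_graph_finite_edges[OF assms]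
    by (auto simp: vertices_of_color_def edges_of_color_def simple_graph_def)
  then show ?thesis
    by (simp add: color_class_def card_Plus)
qed

text \<open>Each vertex sees color \<open>i\<close> once, on itself or on its matching edge, and
  each edge of color \<open>i\<close> serves two vertices.\<close>

lemma card_verts_total_coloring:
  assumes G: "simple_graph G" and regular: "\<forall>v\<in>verts G. degree G v = k"
    and f: "total_coloring (Suc k) G f" and i: "i \<in> {1..Suc k}"
  shows "card (verts G) = card (vertices_of_color G f i) + 2 * card (edges_of_color G f i)"
proof -
  let ?S = "vertices_of_color G f i"
  have S: "?S \<subseteq> verts G" and fin: "finite (verts G)"
    using G by (auto simp: vertices_of_color_def simple_graph_def)
  have "card (verts G - ?S) = 2 * card (edges_of_color G f i)"
    using card_perfect_matching[OF simple_graph_delete_verts[OF G]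
        total_coloring_perfect_matching[OF assms]]
    by (simp add: delete_verts_def)
  moreover have "card (verts G) = card ?S + card (verts G - ?S)"
    using S fin by (simp add: card_Diff_subset card_mono finite_subset)
  ultimately show ?thesis by simp
qed

section \<open>From partitions and matchings back to a total coloring\<close>

lemma indexed_partition_index_unique:
  assumes "indexed_partition I P A" "i \<in> I" "j \<in> I" "x \<in> P i" "x \<in> P j"
  shows "i = j"
  using assms by (auto simp: indexed_partition_def disjoint_family_on_def)

text \<open>This shows that the color assignment in the converse is well defined: disjointness of
  the parts leaves one color per element.\<close>

lemma indexed_partitions_assigns_colors:
  assumes S: "indexed_partition I S A" and M: "indexed_partition I M B"
  obtains f where "assigns_colors I S M f"
proof
  define f where "f = case_sum (\<lambda>v. THE i. i \<in> I \<and> v \<in> S i) (\<lambda>e. THE i. i \<in> I \<and> e \<in> M i)"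
  show "assigns_colors I S M f"
    unfolding assigns_colors_def f_def
    using indexed_partition_index_unique[OF S] indexed_partition_index_unique[OF M]
    by (auto intro!: the_equality)
qed

text \<open>Every element lies in the part indexed by its own color. Two conflicting elements of
  equal color \<open>i\<close> would therefore lie in \<open>S i\<close> or \<open>M i\<close>,
  which is excluded by independence, by disjointness of the matching, or by the deletion of
  \<open>S i\<close>.\<close>

lemma assigns_colors_total_coloring:
  assumes G: "simple_graph G"
    and S: "indexed_partition {1..k} S (verts G)" "\<forall>i\<in>{1..k}. independent_set G (S i)"
    and M: "indexed_partition {1..k} M (edges G)"
      "\<forall>i\<in>{1..k}. perfect_matching (delete_verts G (S i)) (M i)"
    and f: "assigns_colors {1..k} S M f"
  shows "total_coloring k G f"
proof -
  \<comment> \<open>Some part contains \<open>v\<close> because the parts cover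
    \<open>verts G\<close>, and \<open>assigns_colors\<close> identifies its index with the color of
    \<open>v\<close>.\<close>
  have vert: "f (Inl v) \<in> {1..k} \<and> v \<in> S (f (Inl v))" if "v \<in> verts G" for v
    using that S(1) f unfolding indexed_partition_def assigns_colors_def by fastforce
  have edge: "f (Inr e) \<in> {1..k} \<and> e \<in> M (f (Inr e))" if "e \<in> edges G" for e
    using that M(1) f unfolding indexed_partition_def assigns_colors_def by fastforce
  show ?thesis
    unfolding total_coloring_def
  proof (intro conjI ballI impI)
    fix x assume "x \<in> verts G <+> edges G"
    then show "f x \<in> {1..k}"
      using vert edge by auto
  next
    fix u v assume "u \<in> verts G" "v \<in> verts G" "{u, v} \<in> edges G"
    then show "f (Inl u) \<noteq> f (Inl v)"
      using vert S(2) unfolding independent_set_def by metis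
  next
    fix d e assume "d \<in> edges G" "e \<in> edges G" "d \<noteq> e \<and> d \<inter> e \<noteq> {}"
    then show "f (Inr d) \<noteq> f (Inr e)"
      using edge M(2) unfolding perfect_matching_def disjoint_def by metis
  next
    fix v e assume v: "v \<in> verts G" and e: "e \<in> edges G" "v \<in> e"
    have "perfect_matching (delete_verts G (S (f (Inr e)))) (M (f (Inr e)))"
      using edge[OF e(1)] M(2) by blast
    then have "e \<subseteq> verts G - S (f (Inr e))"
      using edge[OF e(1)] by (auto simp: perfect_matching_def delete_verts_def)
    then show "f (Inl v) \<noteq> f (Inr e)"
      using vert[OF v] e(2) by auto
  qed
qed

theorem lemma3p1:
  fixes G :: "'a pregraph" and n :: nat
  assumes "cubic_graph G" and "card (verts G) = n"
  shows
    "(\<forall>f. total_coloring 4 G f \<longrightarrow>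
        (let S = vertices_of_color G f; M = edges_of_color G f; c = color_class G f in
          (indexed_partition {1..4} S (verts G) \<and> (\<forall>i\<in>{1..4}. independent_set G (S i))) \<and>
          (\<forall>i\<in>{1..4}. perfect_matching (delete_verts G (S i)) (M i)) \<and>
          (indexed_partition {1..4} M (edges G) \<and> (verts G \<noteq> {} \<longrightarrow> (\<forall>i\<in>{1..4}. M i \<noteq> {}))) \<and>
          (\<forall>i\<in>{1..4}. even (card (S i)) \<and> real (card (c i)) = (real n + real (card (S i))) / 2)))
     \<and>
     (\<forall>(S :: nat \<Rightarrow> 'a set) (M :: nat \<Rightarrow> 'a set set).
        indexed_partition {1..4} S (verts G) \<and> (\<forall>i\<in>{1..4}. independent_set G (S i)) \<and>
        indexed_partition {1..4} M (edges G) \<and>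
        (\<forall>i\<in>{1..4}. perfect_matching (delete_verts G (S i)) (M i)) \<longrightarrow>
          (\<exists>f. assigns_colors {1..4} S M f) \<and>
          (\<forall>f. assigns_colors {1..4} S M f \<longrightarrow> total_coloring 4 G f))"
proof (intro conjI allI impI)
  have G: "simple_graph G" and regular: "\<forall>v\<in>verts G. degree G v = 3"
    using assms(1) by (auto simp: cubic_graph_def)
  fix f assume f4: "total_coloring 4 G f"
  \<comment> \<open>The general lemmas speak of \<open>Suc k\<close> colors, with \<open>k\<close>
    the common degree; here \<open>k = 3\<close>.\<close>
  then have f: "total_coloring (Suc 3) G f" by simp
  have matching: "perfect_matching (delete_verts G (vertices_of_color G f i)) (edges_of_color G f i)"
    if "i \<in> {1..4}" for i
    using total_coloring_perfect_matching[OF G regular f] that by simp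
  \<comment> \<open>A vertex has degree 3, so there is an edge; its endpoints cannot both lie in the
    independent set of color \<open>i\<close>, so the matching has a vertex to cover.\<close>
  have nonempty: "edges_of_color G f i \<noteq> {}" if "verts G \<noteq> {}" "i \<in> {1..4}" for i
  proof -
    obtain v where "v \<in> verts G" using \<open>verts G \<noteq> {}\<close> by blast
    then have "card {e \<in> edges G. v \<in> e} \<noteq> 0"
      using regular by (simp add: degree_def)
    then obtain e where "e \<in> edges G"
      by (metis (mono_tags, lifting) card.empty empty_Collect_eq)
    then show ?thesis
      using perfect_matching_delete_independent_nonempty[OF G]
        total_coloring_independent_set[OF f] matching[OF that(2)] by blast
  qed
  have order: "n = card (vertices_of_color G f i) + 2 * card (edges_of_color G f i)"
    if "i \<in> {1..4}" for i
    using card_verts_total_coloring[OF G regular f] that assms(2) by simp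
  have "even n"
    using cubic_graph_even_order[OF assms(1)] assms(2) by simp
  have even: "even (card (vertices_of_color G f i))" if "i \<in> {1..4}" for i
    using order[OF that] \<open>even n\<close> by simp
  \<comment> \<open>Here \<open>order\<close> gives the number of edges of color \<open>i\<close> as
    half of \<open>n\<close> minus the number of vertices of color \<open>i\<close>; adding the
    latter gives the formula.\<close>
  have "real (card (color_class G f i)) = (real n + real (card (vertices_of_color G f i))) / 2"
    if "i \<in> {1..4}" for i
    using order[OF that] card_color_class[OF G, of f i] by simp
  with even matching nonempty
  show "let S = vertices_of_color G f; M = edges_of_color G f; c = color_class G f in
          (indexed_partition {1..4} S (verts G) \<and> (\<forall>i\<in>{1..4}. independent_set G (S i))) \<and>
          (\<forall>i\<in>{1..4}. perfect_matching (delete_verts G (S i)) (M i)) \<and>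
          (indexed_partition {1..4} M (edges G) \<and> (verts G \<noteq> {} \<longrightarrow> (\<forall>i\<in>{1..4}. M i \<noteq> {}))) \<and>
          (\<forall>i\<in>{1..4}. even (card (S i)) \<and> real (card (c i)) = (real n + real (card (S i))) / 2)"
    unfolding Let_def
    using total_coloring_indexed_partition_vertices[OF f4]
      total_coloring_indexed_partition_edges[OF f4] total_coloring_independent_set[OF f4]
    by blast
next
  fix S :: "nat \<Rightarrow> 'a set" and M :: "nat \<Rightarrow> 'a set set"
  assume "indexed_partition {1..4} S (verts G) \<and> (\<forall>i\<in>{1..4}. independent_set G (S i)) \<and>
    indexed_partition {1..4} M (edges G) \<and>
    (\<forall>i\<in>{1..4}. perfect_matching (delete_verts G (S i)) (M i))"
  then show "\<exists>f. assigns_colors {1..4} S M f"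
    by (meson indexed_partitions_assigns_colors)
next
  fix S :: "nat \<Rightarrow> 'a set" and M :: "nat \<Rightarrow> 'a set set" and f
  assume "indexed_partition {1..4} S (verts G) \<and> (\<forall>i\<in>{1..4}. independent_set G (S i)) \<and>
    indexed_partition {1..4} M (edges G) \<and>
    (\<forall>i\<in>{1..4}. perfect_matching (delete_verts G (S i)) (M i))"
    and "assigns_colors {1..4} S M f"
  moreover have "simple_graph G"
    using assms(1) by (simp add: cubic_graph_def)
  ultimately show "total_coloring 4 G f"
    by (blast intro: assigns_colors_total_coloring)
qed

end
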